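(* Let $H$ be a real Hilbert space and let $(P_j)_{j\ge 0}$ be a compatible projection chain in $H$, not all $P_j$ equal to $0$, with $K:=\sup_{j\ge 0}\|P_j\|<\infty$. Let $E_j=\operatorname{ran}(P_j-P_{j-1})$ with $P_{-1}:=0$, let $\vartheta_K=\sqrt{1-K^{-2}}$ and $\sigma_K=\log_2(1+\vartheta_K)$. Let $I=\{r,r+1,\dots,r+n-1\}$ ($r\ge 0$) be a consecutive interval of $n\ge 1$ indices. Then every family $y_j\in E_j$, $j\in I$, satisfies $$\frac{1}{B_K n^{\sigma_K}}\sum_{j\in I}\|y_j\|_H^2\le\Big\|\sum_{j\in I}y_j\Big\|_H^2\le A_K n^{\sigma_K}\sum_{j\in I}\|y_j\|_H^2,$$ where $A_K=1+\vartheta_K$ and $B_K=4K^2(1+\vartheta_K)$.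
   Context: A compatible projection chain in a real Hilbert space $H$ is a sequence $(P_j)_{j\ge 0}$ of bounded linear operators on $H$, each a (not necessarily orthogonal) projection, i.e. $P_j^2=P_j$, such that $P_jP_k=P_{\min\{j,k\}}$ for all $j,k\ge 0$. Operator norms are those induced by the norm of $H$. Since not all $P_j$ vanish, $K\ge 1$, so $0\le\vartheta_K<1$ and $0\le\sigma_K<1$. *)

theory Defs
  imports "HOL-Analysis.Analysis"
begin

text \<open>A real Hilbert space is a type of sort \<open>{real_inner, banach}\<close>. Bounded linear operators are
  elements of \<open>'a \<Rightarrow>\<^sub>L 'a\<close>, whose \<open>norm\<close> is the operator norm.\<close>

definition compatible_projection_chain ::
    "(nat \<Rightarrow> 'a::{real_inner, banach} \<Rightarrow>\<^sub>L 'a) \<Rightarrow> bool" where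
  "compatible_projection_chain P \<longleftrightarrow>
     (\<forall>j. P j o\<^sub>L P j = P j) \<and> (\<forall>j k. P j o\<^sub>L P k = P (min j k))"

text \<open>The case distinction implements the convention \<open>P\<^bsub>-1\<^esub> = 0\<close>.\<close>

definition chain_increment ::
    "(nat \<Rightarrow> 'a::{real_inner, banach} \<Rightarrow>\<^sub>L 'a) \<Rightarrow> nat \<Rightarrow> 'a set" where
  "chain_increment P j = range (blinfun_apply (P j - (if j = 0 then 0 else P (j - 1))))"

text \<open>As a real supremum, this is meaningful only if the norms are bounded above.\<close>

definition chain_bound :: "(nat \<Rightarrow> 'a::{real_inner, banach} \<Rightarrow>\<^sub>L 'a) \<Rightarrow> real" where
  "chain_bound P = (SUP j. norm (P j))"

definition chain_theta :: "real \<Rightarrow> real" where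
  "chain_theta K = sqrt (1 - 1 / K\<^sup>2)"

definition chain_sigma :: "real \<Rightarrow> real" where
  "chain_sigma K = log 2 (1 + chain_theta K)"

definition chain_A :: "real \<Rightarrow> real" where
  "chain_A K = 1 + chain_theta K"

definition chain_B :: "real \<Rightarrow> real" where
  "chain_B K = 4 * K\<^sup>2 * (1 + chain_theta K)"

end

theory Submission
  imports Defs
begin

text \<open>
  Two facts carry the proof.

  \<^item> \<^emph>\<open>Angle.\<close> Let \<open>u\<close> be a sum of increments up to an index \<open>c\<close> and \<open>v\<close> a sum of later ones.
    The projection \<open>P\<^bsub>c\<^esub>\<close> maps \<open>u + t v\<close> to \<open>u\<close>, so \<open>\<parallel>u\<parallel> \<le> K \<parallel>u + t v\<parallel>\<close> for all real \<open>t\<close>, which says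
    that the cosine of the angle between \<open>u\<close> and \<open>v\<close> is at most \<open>\<theta> = sqrt (1 - 1/K\<^sup>2)\<close>. Therefore
    \<open>\<parallel>u + v\<parallel>\<^sup>2 \<le> (1 + \<theta>) (\<parallel>u\<parallel>\<^sup>2 + \<parallel>v\<parallel>\<^sup>2)\<close>. Halving an interval of at most \<open>2\<^sup>m\<close> indices \<open>m\<close> times
    costs the factor \<open>(1 + \<theta>)\<^sup>m\<close>, and \<open>m\<close> can be chosen with \<open>n \<le> 2\<^sup>m \<le> 2 n\<close>, so that this factor is
    at most \<open>(1 + \<theta>) n\<^sup>\<sigma>\<close> with \<open>\<sigma> = log\<^sub>2 (1 + \<theta>)\<close>. This is the upper estimate.

  \<^item> \<^emph>\<open>Duality.\<close> The adjoints of the projections form a chain with the same bound \<open>K\<close>. Let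
    \<open>D\<^sub>j = P\<^sub>j - P\<^bsub>j-1\<^esub>\<close> and \<open>s\<close> the sum of the \<open>y\<^sub>j\<close>. From \<open>D\<^sub>j s = y\<^sub>j\<close> it follows that the
    sum of the \<open>\<parallel>y\<^sub>j\<parallel>\<^sup>2\<close> equals the inner product of \<open>s\<close> with the sum of the adjoint increments
    \<open>z\<^sub>j\<close>, where \<open>z\<^sub>j\<close> is the image of \<open>y\<^sub>j\<close> under the adjoint of \<open>D\<^sub>j\<close>. The Cauchy-Schwarz
    inequality, the upper estimate for the adjoint chain and \<open>\<parallel>z\<^sub>j\<parallel> \<le> 2 K \<parallel>y\<^sub>j\<parallel>\<close> give the lower
    estimate with the additional factor \<open>4 K\<^sup>2\<close>. Halving the interval directly for the lower
    estimate would cost \<open>1 / (1 - \<theta>) = K\<^sup>2 (1 + \<theta>)\<close> in each step, hence a worse exponent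
    if \<open>K > 1\<close>.

  The adjoints come from the Riesz representation theorem, where completeness enters.
\<close>

section \<open>The angle between complementary blocks\<close>

text \<open>The best choice of \<open>t\<close> is the one for which \<open>u + t v\<close> is orthogonal to \<open>v\<close>.\<close>

lemma inner_le_of_norm_le_translates:
  fixes u v :: "'a::real_inner"
  assumes K: "K \<ge> 1" and le: "\<And>t. norm u \<le> K * norm (u + t *\<^sub>R v)"
  shows "u \<bullet> v \<le> sqrt (1 - 1 / K\<^sup>2) * norm u * norm v"
proof (cases "v = 0")
  case False
  then have v: "v \<bullet> v > 0" by simp
  define t where "t = - (u \<bullet> v) / (v \<bullet> v)"
  have tv: "t * (v \<bullet> v) = - (u \<bullet> v)" using v by (simp add: t_def)
  have "(norm (u + t *\<^sub>R v))\<^sup>2 = u \<bullet> u + 2 * t * (u \<bullet> v) + t * (t * (v \<bullet> v))"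
    by (simp add: power2_norm_eq_inner inner_add_left inner_add_right inner_commute algebra_simps)
  also have "\<dots> = u \<bullet> u + t * (u \<bullet> v)" by (simp add: tv)
  finally have n: "(norm (u + t *\<^sub>R v))\<^sup>2 = u \<bullet> u - (u \<bullet> v)\<^sup>2 / (v \<bullet> v)"
    by (simp add: t_def power2_eq_square)
  have "(norm u)\<^sup>2 \<le> (K * norm (u + t *\<^sub>R v))\<^sup>2"
    using le[of t] by (intro power_mono) auto
  then have "u \<bullet> u \<le> K\<^sup>2 * (u \<bullet> u - (u \<bullet> v)\<^sup>2 / (v \<bullet> v))"
    by (simp only: power_mult_distrib n) (simp only: power2_norm_eq_inner)
  then have "(u \<bullet> u) / K\<^sup>2 \<le> u \<bullet> u - (u \<bullet> v)\<^sup>2 / (v \<bullet> v)"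
    using K by (simp add: divide_le_eq mult.commute)
  then have "(u \<bullet> v)\<^sup>2 / (v \<bullet> v) \<le> (1 - 1 / K\<^sup>2) * (u \<bullet> u)"
    by (simp add: algebra_simps)
  then have "(u \<bullet> v)\<^sup>2 \<le> (1 - 1 / K\<^sup>2) * (u \<bullet> u) * (v \<bullet> v)"
    using v by (simp add: divide_le_eq)
  then have "\<bar>u \<bullet> v\<bar> \<le> sqrt ((1 - 1 / K\<^sup>2) * (u \<bullet> u) * (v \<bullet> v))"
    by (metis real_sqrt_abs real_sqrt_le_mono)
  also have "\<dots> = sqrt (1 - 1 / K\<^sup>2) * norm u * norm v"
    by (simp only: real_sqrt_mult norm_eq_sqrt_inner)
  finally show ?thesis by linarith
qed simp

lemma chain_theta_nonneg: "K \<ge> 1 \<Longrightarrow> chain_theta K \<ge> 0"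
  by (simp add: chain_theta_def)

lemma norm_add_sq_le_of_norm_le_translates:
  fixes u v :: "'a::real_inner"
  assumes K: "K \<ge> 1" and le: "\<And>t. norm u \<le> K * norm (u + t *\<^sub>R v)"
  shows "(norm (u + v))\<^sup>2 \<le> (1 + chain_theta K) * ((norm u)\<^sup>2 + (norm v)\<^sup>2)"
proof -
  have "2 * (norm u * norm v) \<le> (norm u)\<^sup>2 + (norm v)\<^sup>2"
    using sum_squares_bound[of "norm u" "norm v"] by simp
  then have "chain_theta K * (2 * (norm u * norm v)) \<le> chain_theta K * ((norm u)\<^sup>2 + (norm v)\<^sup>2)"
    using chain_theta_nonneg[OF K] by (rule mult_left_mono)
  moreover have "u \<bullet> v \<le> chain_theta K * (norm u * norm v)"
    using inner_le_of_norm_le_translates[OF assms] by (simp add: chain_theta_def mult.assoc)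
  moreover have "(norm (u + v))\<^sup>2 = (norm u)\<^sup>2 + (norm v)\<^sup>2 + 2 * (u \<bullet> v)"
    by (simp add: power2_norm_eq_inner inner_add_left inner_add_right inner_commute)
  ultimately show ?thesis by (simp add: algebra_simps)
qed

section \<open>Chains of linear maps and the upper estimate\<close>

text \<open>The maps are plain functions rather than bounded operators, so that the adjoint chain fits
  the same locale without being packaged first.\<close>

locale bounded_chain =
  fixes Q :: "nat \<Rightarrow> 'a::real_inner \<Rightarrow> 'a" and K :: real
  assumes linear: "linear (Q j)"
    and compatible: "Q j (Q k x) = Q (min j k) x"
    and norm_le: "norm (Q j x) \<le> K * norm x"
    and bound_ge_1: "K \<ge> 1"
begin

definition increment :: "nat \<Rightarrow> 'a \<Rightarrow> 'a" where
  "increment j x = Q j x - (if j = 0 then 0 else Q (j - 1) x)"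

lemma linear_increment: "linear (increment j)"
  by (rule linearI) (simp_all add: increment_def linear_add[OF linear] linear_scale[OF linear]
      scaleR_diff_right)

lemma truncate_increment: "Q j (increment i x) = (if i \<le> j then increment i x else 0)"
  by (auto simp: increment_def linear_diff[OF linear] compatible linear_0[OF linear]
      min.absorb1 min.absorb2)

lemma increment_increment: "increment j (increment i x) = (if i = j then increment i x else 0)"
  unfolding increment_def[of j "increment i x"] by (auto simp: truncate_increment)

lemma increment_sum:
  assumes "finite I" "j \<in> I" "\<And>i. i \<in> I \<Longrightarrow> y i \<in> range (increment i)"
  shows "increment j (\<Sum>i\<in>I. y i) = y j"
proof -
  have "increment j (y i) = (if i = j then y i else 0)" if "i \<in> I" for i
    using assms(3)[OF that] increment_increment by auto
  then have "increment j (\<Sum>i\<in>I. y i) = (\<Sum>i\<in>I. if i = j then y i else 0)"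
    by (simp add: linear_sum[OF linear_increment])
  then show ?thesis using assms by simp
qed

lemma norm_increment_le: "norm (increment j x) \<le> 2 * K * norm x"
proof (cases "j = 0")
  case True
  have "K * norm x \<ge> 0" using bound_ge_1 by simp
  then show ?thesis using True norm_le[of j x] by (simp add: increment_def)
next
  case False
  then show ?thesis
    using norm_le[of j x] norm_le[of "j - 1" x] norm_triangle_ineq4[of "Q j x" "Q (j - 1) x"]
    by (simp add: increment_def)
qed

lemma norm_sum_sq_le_dyadic:
  assumes "b \<le> a + 2 ^ m" "\<And>i. i \<in> {a..<b} \<Longrightarrow> y i \<in> range (increment i)"
  shows "(norm (\<Sum>i\<in>{a..<b}. y i))\<^sup>2 \<le> (1 + chain_theta K) ^ m * (\<Sum>i\<in>{a..<b}. (norm (y i))\<^sup>2)"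
  using assms
proof (induction m arbitrary: a b)
  case 0
  then have "{a..<b} = {} \<or> {a..<b} = {a}" by auto
  then show ?case by auto
next
  case (Suc m)
  let ?A = "1 + chain_theta K" and ?N = "\<lambda>J. \<Sum>i\<in>J. (norm (y i))\<^sup>2"
  have A: "?A \<ge> 1" using chain_theta_nonneg[OF bound_ge_1] by simp
  define c where "c = a + 2 ^ m"
  show ?case
  proof (cases "b \<le> c")
    case True
    then have "(norm (\<Sum>i\<in>{a..<b}. y i))\<^sup>2 \<le> ?A ^ m * ?N {a..<b}"
      using Suc by (simp add: c_def)
    also have "\<dots> \<le> ?A ^ Suc m * ?N {a..<b}"
      using A by (intro mult_right_mono power_increasing sum_nonneg) auto
    finally show ?thesis .
  next
    case False
    have ac: "a < c" by (simp add: c_def)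
    let ?u = "\<Sum>i\<in>{a..<c}. y i" and ?v = "\<Sum>i\<in>{c..<b}. y i"
    \<comment> \<open>The last index of the left block is \<open>c - 1\<close>; no underflow, because the block is nonempty.\<close>
    have "Q (c - 1) (y i) = (if i < c then y i else 0)" if "i \<in> {a..<b}" for i
      using Suc.prems(2)[OF that] ac by (auto simp: truncate_increment)
    then have Qu: "Q (c - 1) ?u = ?u" and Qv: "Q (c - 1) ?v = 0"
      using False ac by (simp_all add: linear_sum[OF linear])
    have "norm ?u \<le> K * norm (?u + t *\<^sub>R ?v)" for t
      using norm_le[of "c - 1" "?u + t *\<^sub>R ?v"]
      by (simp only: linear_add[OF linear] linear_scale[OF linear] Qu Qv scaleR_zero_right add_0_right)
    then have "(norm (?u + ?v))\<^sup>2 \<le> ?A * ((norm ?u)\<^sup>2 + (norm ?v)\<^sup>2)"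
      by (rule norm_add_sq_le_of_norm_le_translates[OF bound_ge_1])
    also have "\<dots> \<le> ?A * (?A ^ m * ?N {a..<c} + ?A ^ m * ?N {c..<b})"
      using A Suc.prems False ac
      by (intro mult_left_mono add_mono Suc.IH) (auto simp: c_def)
    also have "\<dots> = ?A ^ Suc m * (?N {a..<c} + ?N {c..<b})"
      by (simp add: algebra_simps)
    finally show ?thesis
      using False ac by (simp add: sum.atLeastLessThan_concat)
  qed
qed

end

text \<open>The exponent \<open>\<sigma>\<close> is defined by \<open>2\<^sup>\<sigma> = 1 + \<theta>\<close>, so \<open>(1 + \<theta>)\<^sup>m = (2\<^sup>m)\<^sup>\<sigma>\<close>; for \<open>m\<close> take the number
  of binary digits of \<open>n\<close>.\<close>

lemma dyadic_exponent:
  assumes K: "K \<ge> 1" and n: "n \<ge> 1"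
  obtains m where "n \<le> 2 ^ m"
    "(1 + chain_theta K) ^ m \<le> chain_A K * real n powr chain_sigma K"
proof -
  obtain k where k: "2 ^ k \<le> n" "n < 2 ^ (k + 1)"
    using ex_power_ivl1[of 2 n] n by auto
  have th: "chain_theta K \<ge> 0" by (rule chain_theta_nonneg[OF K])
  then have s: "2 powr chain_sigma K = 1 + chain_theta K"
    by (simp add: chain_sigma_def)
  have sg: "chain_sigma K \<ge> 0"
    using th by (simp add: chain_sigma_def)
  have "(1 + chain_theta K) ^ k = (2 powr chain_sigma K) ^ k" by (simp add: s)
  also have "\<dots> = (2 powr real k) powr chain_sigma K"
    by (simp add: powr_power powr_powr mult.commute)
  also have "\<dots> = (2 ^ k) powr chain_sigma K" by (simp add: powr_realpow)
  also have "\<dots> \<le> real n powr chain_sigma K"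
    using of_nat_mono[OF k(1), where 'a=real] sg by (intro powr_mono2) simp_all
  finally have "(1 + chain_theta K) ^ (k + 1) \<le> chain_A K * real n powr chain_sigma K"
    using th by (simp add: chain_A_def)
  then show ?thesis using that[of "k + 1"] k(2) by simp
qed

lemma (in bounded_chain) norm_sum_sq_le:
  assumes n: "n \<ge> 1" and y: "\<And>i. i \<in> {r..<r + n} \<Longrightarrow> y i \<in> range (increment i)"
  shows "(norm (\<Sum>i\<in>{r..<r + n}. y i))\<^sup>2
    \<le> chain_A K * real n powr chain_sigma K * (\<Sum>i\<in>{r..<r + n}. (norm (y i))\<^sup>2)"
proof -
  obtain m where m: "n \<le> 2 ^ m"
    "(1 + chain_theta K) ^ m \<le> chain_A K * real n powr chain_sigma K"
    by (rule dyadic_exponent[OF bound_ge_1 n])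
  have "(norm (\<Sum>i\<in>{r..<r + n}. y i))\<^sup>2
    \<le> (1 + chain_theta K) ^ m * (\<Sum>i\<in>{r..<r + n}. (norm (y i))\<^sup>2)"
    using m(1) y by (intro norm_sum_sq_le_dyadic) auto
  also have "\<dots> \<le> chain_A K * real n powr chain_sigma K * (\<Sum>i\<in>{r..<r + n}. (norm (y i))\<^sup>2)"
    using m(2) by (intro mult_right_mono sum_nonneg) auto
  finally show ?thesis .
qed

section \<open>Riesz representation and adjoints\<close>

text \<open>The representing vector is the minimiser of \<open>J x = \<parallel>x\<parallel>\<^sup>2 - 2 f x\<close>. The parallelogram law makes
  every minimising sequence Cauchy, and the first variation of \<open>J\<close> vanishes at the minimiser.\<close>

lemma riesz_representation:
  fixes f :: "'a::{real_inner, banach} \<Rightarrow> real"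
  assumes f: "bounded_linear f"
  obtains v where "\<And>x. f x = x \<bullet> v"
proof -
  interpret f: bounded_linear f by (rule f)
  define J where "J x = x \<bullet> x - 2 * f x" for x
  obtain C where C: "\<And>x. norm (f x) \<le> norm x * C" using f.bounded by blast
  have "J x \<ge> - (C\<^sup>2)" for x
  proof -
    have "(norm x - C)\<^sup>2 \<ge> 0" by simp
    then show ?thesis
      using C[of x] by (simp add: J_def power2_diff power2_norm_eq_inner)
  qed
  then have bdd: "bdd_below (range J)" by (auto intro!: bdd_belowI)
  define \<mu> where "\<mu> = Inf (range J)"
  have J_ge: "\<mu> \<le> J x" for x
    unfolding \<mu>_def by (rule cInf_lower[OF _ bdd]) simp
  have "\<exists>x. J x < \<mu> + 1 / real (Suc k)" for k
    using cInf_lessD[of "range J" "\<mu> + 1 / real (Suc k)"] by (auto simp: \<mu>_def)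
  then obtain a where a: "\<And>k. J (a k) < \<mu> + 1 / real (Suc k)" by metis
  have para: "(norm (x - z))\<^sup>2 = 2 * J x + 2 * J z - 4 * J ((1 / 2) *\<^sub>R (x + z))" for x z
    by (simp add: J_def power2_norm_eq_inner f.scaleR f.add inner_add_left inner_add_right
        inner_diff_left inner_diff_right inner_commute algebra_simps)
  have "Cauchy a"
  proof (rule metric_CauchyI)
    fix e :: real assume e: "e > 0"
    obtain N where N: "inverse (real (Suc N)) < e\<^sup>2 / 4"
      using reals_Archimedean[of "e\<^sup>2 / 4"] e by auto
    show "\<exists>M. \<forall>k\<ge>M. \<forall>l\<ge>M. dist (a k) (a l) < e"
    proof (intro exI allI impI)
      fix k l assume kl: "k \<ge> N" "l \<ge> N"
      have "1 / real (Suc k) \<le> inverse (real (Suc N))" "1 / real (Suc l) \<le> inverse (real (Suc N))"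
        using kl by (auto simp: field_simps)
      then have "(norm (a k - a l))\<^sup>2 < e\<^sup>2"
        using para[of "a k" "a l"] J_ge[of "(1 / 2) *\<^sub>R (a k + a l)"] a[of k] a[of l] N by linarith
      then show "dist (a k) (a l) < e"
        using e by (simp add: dist_norm power2_less_imp_less)
    qed
  qed
  then obtain v where v: "a \<longlonglongrightarrow> v" using Cauchy_convergent convergent_def by blast
  have "(\<lambda>k. J (a k)) \<longlonglongrightarrow> J v"
    unfolding J_def by (intro tendsto_intros f.tendsto v)
  moreover have "(\<lambda>k. \<mu> + 1 / real (Suc k)) \<longlonglongrightarrow> \<mu> + 0"
    by (intro tendsto_add tendsto_const LIMSEQ_Suc[OF lim_1_over_n])
  ultimately have "J v \<le> \<mu> + 0"
    by (rule LIMSEQ_le) (use a less_imp_le in blast)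
  then have J_min: "J v \<le> J x" for x using J_ge[of x] by simp
  have "f x = x \<bullet> v" for x
  proof -
    define d where "d = x \<bullet> v - f x"
    define s where "s = x \<bullet> x + 1"
    have s: "s > 0" by (simp add: s_def add_nonneg_pos)
    \<comment> \<open>Any small step against the sign of \<open>d\<close> lowers \<open>J\<close> if \<open>d \<noteq> 0\<close>; the summand \<open>1\<close> in \<open>s\<close> covers
      the case \<open>x = 0\<close>.\<close>
    define t where "t = - d / s"
    have "J (v + t *\<^sub>R x) = J v + 2 * t * d + t\<^sup>2 * (s - 1)"
      by (simp add: J_def d_def s_def f.add f.scaleR inner_add_left inner_add_right inner_commute
          power2_eq_square algebra_simps)
    then have "0 \<le> 2 * t * d + t\<^sup>2 * (s - 1)" using J_min[of "v + t *\<^sub>R x"] by simp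
    moreover have "d = - t * s" using s by (simp add: t_def)
    ultimately have "0 \<le> - (t\<^sup>2 * (s + 1))" by (simp add: power2_eq_square algebra_simps)
    then have "t\<^sup>2 * (s + 1) \<le> 0" by simp
    then have "t = 0" using s by (simp add: mult_le_0_iff)
    then show ?thesis using s by (simp add: t_def d_def)
  qed
  then show ?thesis by (rule that)
qed

lemma adjoint_exists:
  fixes T :: "'a::{real_inner, banach} \<Rightarrow> 'a"
  assumes T: "linear T" and le: "\<And>x. norm (T x) \<le> K * norm x"
  obtains S where "\<And>x z. T x \<bullet> z = x \<bullet> S z"
proof -
  have bl: "bounded_linear T"
    using le by (intro bounded_linear_intro[where K=K])
      (auto simp: linear_add[OF T] linear_scale[OF T] mult.commute)
  have "\<exists>w. \<forall>x. T x \<bullet> z = x \<bullet> w" for z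
    using riesz_representation[OF bounded_linear_inner_left_comp[OF bl, of z]] by metis
  then show ?thesis using that by metis
qed

lemma eq_if_inner_eq:
  fixes v w :: "'a::real_inner"
  assumes "\<And>x. x \<bullet> v = x \<bullet> w"
  shows "v = w"
  using assms vector_eq_ldot by blast

text \<open>Passing to adjoints reverses products, but \<open>min j k\<close> is symmetric in \<open>j\<close> and \<open>k\<close>.\<close>

lemma bounded_chain_adjoint:
  fixes Q R :: "nat \<Rightarrow> 'a::real_inner \<Rightarrow> 'a"
  assumes Q: "bounded_chain Q K" and adj: "\<And>j x z. Q j x \<bullet> z = x \<bullet> R j z"
  shows "bounded_chain R K"
proof -
  interpret bounded_chain Q K by (rule Q)
  show ?thesis
  proof (rule bounded_chain.intro)
    show "linear (R j)" for j
      by (rule linearI; rule eq_if_inner_eq) (simp_all add: inner_add_right flip: adj)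
    show "R j (R k x) = R (min j k) x" for j k x
      by (rule eq_if_inner_eq) (simp add: compatible min.commute flip: adj)
    show "norm (R j z) \<le> K * norm z" for j z
    proof -
      have "norm (R j z) * norm (R j z) = Q j (R j z) \<bullet> z"
        by (simp add: adj flip: power2_norm_eq_inner power2_eq_square)
      also have "\<dots> \<le> norm (Q j (R j z)) * norm z" by (rule norm_cauchy_schwarz)
      also have "\<dots> \<le> (K * norm (R j z)) * norm z" by (intro mult_right_mono norm_le) simp
      finally have "norm (R j z) * norm (R j z) \<le> norm (R j z) * (K * norm z)"
        by (simp add: mult.left_commute mult.assoc)
      then show ?thesis
        using bound_ge_1 by (cases "R j z = 0") auto
    qed
    show "K \<ge> 1" by (rule bound_ge_1)
  qed
qed

section \<open>The lower estimate by duality\<close>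

lemma sum_norm_sq_le_norm_sum_sq:
  fixes Q :: "nat \<Rightarrow> 'a::{real_inner, banach} \<Rightarrow> 'a"
  assumes Q: "bounded_chain Q K" and n: "n \<ge> 1"
    and y: "\<And>i. i \<in> {r..<r + n} \<Longrightarrow> y i \<in> range (bounded_chain.increment Q i)"
  shows "(\<Sum>i\<in>{r..<r + n}. (norm (y i))\<^sup>2)
    \<le> chain_B K * real n powr chain_sigma K * (norm (\<Sum>i\<in>{r..<r + n}. y i))\<^sup>2"
proof -
  interpret Q: bounded_chain Q K by (rule Q)
  have "\<exists>S. \<forall>x z. Q j x \<bullet> z = x \<bullet> S z" for j
    using adjoint_exists[OF Q.linear Q.norm_le] by metis
  then obtain R where adj: "\<And>j x z. Q j x \<bullet> z = x \<bullet> R j z" by metis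
  interpret R: bounded_chain R K by (rule bounded_chain_adjoint[OF Q adj])
  have adj_inc: "Q.increment j x \<bullet> z = x \<bullet> R.increment j z" for j x z
    by (simp add: Q.increment_def R.increment_def inner_diff_left inner_diff_right adj)
  define I where "I = {r..<r + n}"
  define s where "s = (\<Sum>i\<in>I. y i)"
  define z where "z i = R.increment i (y i)" for i
  define N where "N = (\<Sum>i\<in>I. (norm (y i))\<^sup>2)"
  let ?C = "chain_A K * real n powr chain_sigma K"
  have C: "?C \<ge> 0" using chain_theta_nonneg[OF Q.bound_ge_1] by (simp add: chain_A_def)
  have N0: "N \<ge> 0" by (simp add: N_def sum_nonneg)
  have "N = (\<Sum>i\<in>I. s \<bullet> z i)"
    unfolding N_def
  proof (rule sum.cong)
    fix i assume i: "i \<in> I"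
    then have "y i = Q.increment i s"
      unfolding s_def by (intro Q.increment_sum[symmetric]) (use y I_def in auto)
    then show "(norm (y i))\<^sup>2 = s \<bullet> z i"
      by (metis adj_inc power2_norm_eq_inner z_def)
  qed simp
  also have "\<dots> \<le> norm s * norm (\<Sum>i\<in>I. z i)"
    by (simp add: norm_cauchy_schwarz flip: inner_sum_right)
  finally have "N\<^sup>2 \<le> (norm s)\<^sup>2 * (norm (\<Sum>i\<in>I. z i))\<^sup>2"
    using power_mono[OF _ N0, of _ 2] by (simp flip: power_mult_distrib)
  also have "(norm s)\<^sup>2 * (norm (\<Sum>i\<in>I. z i))\<^sup>2 \<le> (norm s)\<^sup>2 * (?C * (4 * K\<^sup>2 * N))"
  proof (rule mult_left_mono)
    have "(norm (\<Sum>i\<in>I. z i))\<^sup>2 \<le> ?C * (\<Sum>i\<in>I. (norm (z i))\<^sup>2)"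
      unfolding I_def by (rule R.norm_sum_sq_le[OF n]) (simp add: z_def)
    also have "\<dots> \<le> ?C * (\<Sum>i\<in>I. (2 * K * norm (y i))\<^sup>2)"
      by (intro mult_left_mono sum_mono power_mono C) (simp_all add: z_def R.norm_increment_le)
    also have "(\<Sum>i\<in>I. (2 * K * norm (y i))\<^sup>2) = 4 * K\<^sup>2 * N"
      by (simp add: N_def sum_distrib_left power_mult_distrib)
    finally show "(norm (\<Sum>i\<in>I. z i))\<^sup>2 \<le> ?C * (4 * K\<^sup>2 * N)" .
  qed simp
  finally have "N * N \<le> N * (chain_B K * real n powr chain_sigma K * (norm s)\<^sup>2)"
    by (simp add: power2_eq_square chain_A_def chain_B_def algebra_simps)
  moreover have "chain_B K * real n powr chain_sigma K * (norm s)\<^sup>2 \<ge> 0"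
    using chain_theta_nonneg[OF Q.bound_ge_1] by (simp add: chain_B_def)
  ultimately have "N \<le> chain_B K * real n powr chain_sigma K * (norm s)\<^sup>2"
    using N0 by (cases "N = 0") auto
  then show ?thesis by (simp add: N_def s_def I_def)
qed

section \<open>The two-sided estimate\<close>

lemma bounded_chain_of_compatible_projection_chain:
  fixes P :: "nat \<Rightarrow> 'a::{real_inner, banach} \<Rightarrow>\<^sub>L 'a"
  assumes P: "compatible_projection_chain P" and nz: "\<exists>j. P j \<noteq> 0"
    and bdd: "bdd_above (range (\<lambda>j. norm (P j)))"
  shows "bounded_chain (\<lambda>j. blinfun_apply (P j)) (chain_bound P)"
proof (rule bounded_chain.intro)
  have le: "norm (P j) \<le> chain_bound P" for j
    unfolding chain_bound_def by (rule cSUP_upper[OF _ bdd]) simp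
  show "linear (blinfun_apply (P j))" for j
    by (simp add: blinfun.bounded_linear_right bounded_linear.linear)
  show "P j (P k x) = P (min j k) x" for j k x
    using P by (metis blinfun_apply_blinfun_compose compatible_projection_chain_def)
  show "norm (P j x) \<le> chain_bound P * norm x" for j x
    by (meson le mult_right_mono norm_blinfun norm_ge_zero order_trans)
  \<comment> \<open>A nonzero idempotent has norm at least \<open>1\<close>.\<close>
  obtain j where j: "P j \<noteq> 0" using nz by blast
  have "norm (P j) \<le> norm (P j) * norm (P j)"
    using P norm_blinfun_compose[of "P j" "P j"] by (simp add: compatible_projection_chain_def)
  then have "norm (P j) \<ge> 1" using j by simp
  then show "chain_bound P \<ge> 1" using le[of j] by linarith
qed

theorem theorem2p3:
  fixes P :: "nat \<Rightarrow> 'a::{real_inner, banach} \<Rightarrow>\<^sub>L 'a"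
    and K :: real and r n :: nat and I :: "nat set" and y :: "nat \<Rightarrow> 'a"
  assumes "compatible_projection_chain P"
    and "\<exists>j. P j \<noteq> 0"
    and "bdd_above (range (\<lambda>j. norm (P j)))"
    and "K = chain_bound P"
    and "n \<ge> 1"
    and "I = {r..<r + n}"
    and "\<And>j. j \<in> I \<Longrightarrow> y j \<in> chain_increment P j"
  shows "1 / (chain_B K * real n powr chain_sigma K) * (\<Sum>j\<in>I. (norm (y j))\<^sup>2)
           \<le> (norm (\<Sum>j\<in>I. y j))\<^sup>2
       \<and> (norm (\<Sum>j\<in>I. y j))\<^sup>2
           \<le> chain_A K * real n powr chain_sigma K * (\<Sum>j\<in>I. (norm (y j))\<^sup>2)"
proof
  have chain: "bounded_chain (\<lambda>j. blinfun_apply (P j)) K"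
    using bounded_chain_of_compatible_projection_chain assms by blast
  interpret bounded_chain "\<lambda>j. blinfun_apply (P j)" K by (rule chain)
  have inc: "chain_increment P j = range (increment j)" for j
    by (auto simp: chain_increment_def increment_def blinfun.diff_left)
  have y: "y j \<in> range (increment j)" if "j \<in> {r..<r + n}" for j
    using assms(6,7) that inc by simp
  show "(norm (\<Sum>j\<in>I. y j))\<^sup>2
      \<le> chain_A K * real n powr chain_sigma K * (\<Sum>j\<in>I. (norm (y j))\<^sup>2)"
    using norm_sum_sq_le[OF assms(5) y] assms(6) by simp
  have "chain_B K * real n powr chain_sigma K > 0"
    using bound_ge_1 chain_theta_nonneg[OF bound_ge_1] assms(5)
    by (simp add: chain_B_def add_pos_nonneg)
  moreover have "(\<Sum>j\<in>I. (norm (y j))\<^sup>2)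
      \<le> chain_B K * real n powr chain_sigma K * (norm (\<Sum>j\<in>I. y j))\<^sup>2"
    using sum_norm_sq_le_norm_sum_sq[OF chain assms(5) y] assms(6) by simp
  ultimately show "1 / (chain_B K * real n powr chain_sigma K) * (\<Sum>j\<in>I. (norm (y j))\<^sup>2)
      \<le> (norm (\<Sum>j\<in>I. y j))\<^sup>2"
    by (simp add: divide_le_eq mult.commute)
qed

end
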